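(* Let $\mathcal{U}$ be a stable ordered-union ultrafilter on $\mathrm{FIN}$. Then $\mathcal{U} >_T \mathcal{U}_{\operatorname{minmax}}$; that is, $\mathcal{U}_{\operatorname{minmax}} \leq_T \mathcal{U}$ and $\mathcal{U} \not\leq_T \mathcal{U}_{\operatorname{minmax}}$.
   Context: $\mathrm{FIN}$ is the set of all finite nonempty subsets of $\omega$. An infinite block sequence is a map $X : \omega \to \mathrm{FIN}$ with $\max(X(i)) < \min(X(i+1))$ for all $i$; $\mathrm{FIN}^{[\infty]}$ is the set of all infinite block sequences. For $X \in \mathrm{FIN}^{[\infty]}$, $[X] = \{ \bigcup_{i \in F} X(i) : F \subseteq \omega \text{ finite nonempty}\} \subseteq \mathrm{FIN}$. Write $X \leq Y$ iff $X(i) \in [Y]$ for all $i$. For $n\in\omega$, $X/n = (X(i))_{i \geq i_0}$ (re-indexed from $0$), where $i_0$ is least with $\min(X(i_0)) > n$. Write $X \leq^* Y$ iff there is $n \in \omega$ with $X/n \leq Y$. An ultrafilter $\mathcal{U}$ on $\mathrm{FIN}$ is ordered-union if it has a filter base all of whose members have the form $[X]$ for some $X \in \mathrm{FIN}^{[\infty]}$. It is stable ordered-union if it is ordered-union and for every sequence $(X_i)_{i \in \omega}$ in $\mathrm{FIN}^{[\infty]}$ with $[X_i] \in \mathcal{U}$ and $X_{i+1} \leq^* X_i$ for all $i$, there is $X\in\mathrm{FIN}^{[\infty]}$ with $[X] \in \mathcal{U}$ and $X \leq^* X_i$ for all $i$. Let $\operatorname{minmax} : \mathrm{FIN} \to \omega^2$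 be $\operatorname{minmax}(s) = (\min(s), \max(s))$, and let $\mathcal{U}_{\operatorname{minmax}} = \{Y \subseteq \omega^2 : \operatorname{minmax}^{-1}(Y) \in \mathcal{U}\}$, an ultrafilter on $\omega^2$. A filter base for an ultrafilter $\mathcal{V}$ is a set $\mathcal{B} \subseteq \mathcal{V}$ such that every $V \in \mathcal{V}$ contains some $B \in \mathcal{B}$. For ultrafilters $\mathcal{V}, \mathcal{W}$ on countable sets, $\mathcal{V} \leq_T \mathcal{W}$ ($\mathcal{V}$ is Tukey reducible to $\mathcal{W}$) means there is a map $f : \mathcal{W} \to \mathcal{V}$ such that for every filter base $\mathcal{B}$ for $\mathcal{W}$, $f[\mathcal{B}]$ is a filter base for $\mathcal{V}$. *)

theory Defs
  imports Main
begin

text \<open>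
  Ultrafilters are families of subsets of an explicit ground set, because the ground set FIN is a
  proper subset of its type.
\<close>

definition ultrafilter_on :: "'a set \<Rightarrow> 'a set set \<Rightarrow> bool" where
  "ultrafilter_on S U \<longleftrightarrow>
     U \<subseteq> Pow S \<and> S \<in> U \<and> {} \<notin> U \<and>
     (\<forall>A\<in>U. \<forall>B. A \<subseteq> B \<and> B \<subseteq> S \<longrightarrow> B \<in> U) \<and>
     (\<forall>A\<in>U. \<forall>B\<in>U. A \<inter> B \<in> U) \<and>
     (\<forall>A. A \<subseteq> S \<longrightarrow> A \<in> U \<or> S - A \<in> U)"

definition filter_base_of :: "'a set set \<Rightarrow> 'a set set \<Rightarrow> bool" where
  "filter_base_of V B \<longleftrightarrow> B \<subseteq> V \<and> (\<forall>A\<in>V. \<exists>C\<in>B. C \<subseteq> A)"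

definition tukey_le :: "'a set set \<Rightarrow> 'b set set \<Rightarrow> bool" (infix "\<le>\<^sub>T" 50) where
  "V \<le>\<^sub>T W \<longleftrightarrow>
     (\<exists>f. (\<forall>A\<in>W. f A \<in> V) \<and> (\<forall>B. filter_base_of W B \<longrightarrow> filter_base_of V (f ` B)))"

definition FIN :: "nat set set" where
  "FIN = {s. finite s \<and> s \<noteq> {}}"

definition block_sequences :: "(nat \<Rightarrow> nat set) set" where
  "block_sequences = {X. (\<forall>i. X i \<in> FIN) \<and> (\<forall>i. Max (X i) < Min (X (Suc i)))}"

definition block_span :: "(nat \<Rightarrow> nat set) \<Rightarrow> nat set set" where
  "block_span X = {(\<Union>i\<in>F. X i) | F. finite F \<and> F \<noteq> {}}"

definition block_le :: "(nat \<Rightarrow> nat set) \<Rightarrow> (nat \<Rightarrow> nat set) \<Rightarrow> bool" where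
  "block_le X Y \<longleftrightarrow> (\<forall>i. X i \<in> block_span Y)"

text \<open>
  The tail \<open>X/n\<close>. For a block sequence \<open>X\<close> the minima are unbounded, so the least index exists.
\<close>

definition block_tail :: "(nat \<Rightarrow> nat set) \<Rightarrow> nat \<Rightarrow> nat \<Rightarrow> nat set" where
  "block_tail X n = (\<lambda>i. X ((LEAST i0. n < Min (X i0)) + i))"

definition block_almost_le :: "(nat \<Rightarrow> nat set) \<Rightarrow> (nat \<Rightarrow> nat set) \<Rightarrow> bool" where
  "block_almost_le X Y \<longleftrightarrow> (\<exists>n. block_le (block_tail X n) Y)"

definition ordered_union :: "nat set set set \<Rightarrow> bool" where
  "ordered_union U \<longleftrightarrow>
     ultrafilter_on FIN U \<and>
     (\<exists>B. filter_base_of U B \<and> (\<forall>A\<in>B. \<exists>X\<in>block_sequences. A = block_span X))"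

definition stable_ordered_union :: "nat set set set \<Rightarrow> bool" where
  "stable_ordered_union U \<longleftrightarrow>
     ordered_union U \<and>
     (\<forall>X :: nat \<Rightarrow> nat \<Rightarrow> nat set.
        (\<forall>i. X i \<in> block_sequences \<and> block_span (X i) \<in> U \<and> block_almost_le (X (Suc i)) (X i)) \<longrightarrow>
        (\<exists>Y\<in>block_sequences. block_span Y \<in> U \<and> (\<forall>i. block_almost_le Y (X i))))"

definition minmax :: "nat set \<Rightarrow> nat \<times> nat" where
  "minmax s = (Min s, Max s)"

definition minmax_image :: "nat set set set \<Rightarrow> (nat \<times> nat) set set" where
  "minmax_image U = {Y. {s \<in> FIN. minmax s \<in> Y} \<in> U}"

lemma ultrafilter_on_minmax_image:
  assumes "ultrafilter_on FIN U"
  shows "ultrafilter_on UNIV (minmax_image U)"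
proof -
  have inter: "{s \<in> FIN. minmax s \<in> A \<and> minmax s \<in> B}
      = {s \<in> FIN. minmax s \<in> A} \<inter> {s \<in> FIN. minmax s \<in> B}" for A B
    by blast
  have compl: "{s \<in> FIN. minmax s \<notin> A} = FIN - {s \<in> FIN. minmax s \<in> A}" for A
    by blast
  have up: "{s \<in> FIN. minmax s \<in> B} \<in> U"
    if "{s \<in> FIN. minmax s \<in> A} \<in> U" "A \<subseteq> B" for A B
  proof -
    have "{s \<in> FIN. minmax s \<in> A} \<subseteq> {s \<in> FIN. minmax s \<in> B}"
      using that(2) by blast
    moreover have "{s \<in> FIN. minmax s \<in> B} \<subseteq> FIN" by blast
    ultimately show ?thesis
      using assms that(1) unfolding ultrafilter_on_def by blast
  qed
  have dich: "{s \<in> FIN. minmax s \<in> A} \<in> U \<or> FIN - {s \<in> FIN. minmax s \<in> A} \<in> U" for A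
  proof -
    have "{s \<in> FIN. minmax s \<in> A} \<subseteq> FIN" by blast
    then show ?thesis using assms unfolding ultrafilter_on_def by blast
  qed
  show ?thesis
    using assms up dich
    unfolding ultrafilter_on_def[of UNIV] minmax_image_def
    by (auto simp: inter compl ultrafilter_on_def)
qed

end

theory Submission
  imports Defs
begin

text \<open>
  The image map \<open>A \<mapsto> minmax ` A\<close> witnesses \<open>minmax_image U \<le>\<^sub>T U\<close>. For the converse, suppose that
  \<open>U\<close> is Tukey reducible to its minmax image. The reduction can be made monotone, and since the
  minmax image is generated by pairs consisting of a set of minima and a set of maxima, it becomes
  a monotone map \<open>H A B\<close> with values in \<open>U\<close>, some of them inside any given member of \<open>U\<close>. Abbreviate
  \<open>H(Z) = H (Min ` [Z]) (Max ` [Z])\<close>, where \<open>[Z]\<close> is the span of \<open>Z\<close>. The contradiction comes from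
  the fact that \<open>H(Z)\<close> sees only the end points of the blocks of \<open>Z\<close>, and so cannot notice a change
  in the interior of a block, whereas a suitable member of \<open>U\<close> does.

  Stability is used through diagonalization (\<open>stable_ordered_union_diagonal\<close>): given \<open>D n \<in> U\<close>,
  some \<open>[Y] \<in> U\<close> has \<open>b \<in> D (Max a)\<close> whenever \<open>a < b\<close> in \<open>[Y]\<close>. Applied to the countably many
  finite stems of end points, it yields a decisive \<open>Y\<close> (\<open>ex_decisive\<close>): whether \<open>t\<close> belongs to
  \<open>H(Z)\<close>, for \<open>[Z] \<subseteq> [Y]\<close> and \<open>t \<in> [Z]\<close>, is settled by the end points of the blocks of \<open>Z\<close> up to
  \<open>Max t\<close>, and for \<open>t = r \<union> z\<close> with last block \<open>z\<close> the answer does not depend on which \<open>z \<in> [Y]\<close>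
  continues the stem. Consequently the last block \<open>z\<close> of a \<open>t \<in> H(Z)\<close> may be replaced by any
  \<open>y \<in> [Y]\<close> with the same end points (\<open>replace_last_block\<close>).

  Now colour sets by the parity of the number of blocks \<open>Y j\<close> that they contain, let \<open>T \<in> U\<close> be
  homogeneous, and choose \<open>[Z] \<in> U\<close> with \<open>H(Z) \<subseteq> T\<close> such that every member of \<open>[Z]\<close> omits
  some block \<open>Y j\<close> strictly between its end points. As \<open>H(Z)\<close> and \<open>[Z]\<close> both belong to \<open>U\<close>, they share
  a member \<open>t\<close>; inserting an omitted block into its last piece keeps it in \<open>H(Z)\<close> but flips the
  parity.
\<close>

section \<open>Ultrafilters and Tukey reductions\<close>

lemma ultrafilter_on_Int:
  "ultrafilter_on S U \<Longrightarrow> A \<in> U \<Longrightarrow> B \<in> U \<Longrightarrow> A \<inter> B \<in> U"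
  unfolding ultrafilter_on_def by blast

lemma ultrafilter_on_superset:
  "ultrafilter_on S U \<Longrightarrow> A \<in> U \<Longrightarrow> A \<subseteq> B \<Longrightarrow> B \<subseteq> S \<Longrightarrow> B \<in> U"
  unfolding ultrafilter_on_def by blast

lemma ultrafilter_on_subset: "ultrafilter_on S U \<Longrightarrow> A \<in> U \<Longrightarrow> A \<subseteq> S"
  unfolding ultrafilter_on_def by blast

lemma ultrafilter_on_nonempty: "ultrafilter_on S U \<Longrightarrow> A \<in> U \<Longrightarrow> A \<noteq> {}"
  unfolding ultrafilter_on_def by blast

lemma ultrafilter_on_homogeneous:
  assumes "ultrafilter_on S U"
  obtains A where "A \<in> U" "(\<forall>x\<in>A. P x) \<or> (\<forall>x\<in>A. \<not> P x)"
proof -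
  have "\<forall>A. A \<subseteq> S \<longrightarrow> A \<in> U \<or> S - A \<in> U"
    using assms unfolding ultrafilter_on_def by (elim conjE)
  then have "{x \<in> S. P x} \<in> U \<or> S - {x \<in> S. P x} \<in> U" by simp
  then show ?thesis
    using that[of "{x \<in> S. P x}"] that[of "S - {x \<in> S. P x}"] by auto
qed

lemma ultrafilter_on_finite_INT:
  assumes "ultrafilter_on S U" "finite I" "I \<noteq> {}" "\<And>i. i \<in> I \<Longrightarrow> A i \<in> U"
  shows "(\<Inter>i\<in>I. A i) \<in> U"
  using assms(2-4)
  by (induction I rule: finite_ne_induct) (auto intro: ultrafilter_on_Int[OF assms(1)])

text \<open>
  A map preserving filter bases is cofinal, for otherwise the sets whose images are not below some
  fixed \<open>T\<close> would form a filter base. Taking unions of values over smaller sets makes it monotone.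
\<close>

lemma tukey_le_monotone_cofinal:
  assumes "V \<le>\<^sub>T W" and V: "ultrafilter_on S V"
  obtains g where "\<forall>A\<in>W. g A \<in> V" "mono g" "\<forall>T\<in>V. \<exists>A\<in>W. g A \<subseteq> T"
proof -
  obtain f where f: "\<And>A. A \<in> W \<Longrightarrow> f A \<in> V"
    and base: "\<And>B. filter_base_of W B \<Longrightarrow> filter_base_of V (f ` B)"
    using assms(1) unfolding tukey_le_def by auto
  define g where "g A = (\<Union>C\<in>{C\<in>W. C \<subseteq> A}. f C)" for A
  have 1: "g A \<in> V" if "A \<in> W" for A
  proof -
    have "g A \<subseteq> S" using ultrafilter_on_subset[OF V f] unfolding g_def by blast
    moreover have "f A \<subseteq> g A" using that unfolding g_def by blast
    ultimately show ?thesis by (intro ultrafilter_on_superset[OF V f[OF that]])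
  qed
  have 2: "mono g" unfolding g_def by (rule monoI) auto
  have 3: "\<exists>A\<in>W. g A \<subseteq> T" if "T \<in> V" for T
  proof (rule ccontr)
    assume "\<not> ?thesis"
    then have "\<not> g A \<subseteq> T" if "A \<in> W" for A using that by simp
    then have "\<exists>C\<in>W. C \<subseteq> A \<and> \<not> f C \<subseteq> T" if "A \<in> W" for A
      using that unfolding g_def by (simp add: UN_subset_iff Bex_def conj_assoc)
    then have "filter_base_of W {C\<in>W. \<not> f C \<subseteq> T}"
      unfolding filter_base_of_def by (simp add: Bex_def conj_commute conj_left_commute)
    then have "filter_base_of V (f ` {C\<in>W. \<not> f C \<subseteq> T})" by (rule base)
    then have "\<forall>A\<in>V. \<exists>D \<in> f ` {C\<in>W. \<not> f C \<subseteq> T}. D \<subseteq> A"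
      unfolding filter_base_of_def by (rule conjunct2)
    then have "\<exists>D \<in> f ` {C\<in>W. \<not> f C \<subseteq> T}. D \<subseteq> T" using \<open>T \<in> V\<close> by (rule bspec)
    then show False by simp
  qed
  show ?thesis using that[of g] 1 2 3 by simp
qed

lemma minmax_image_tukey_le:
  assumes U: "ultrafilter_on FIN U"
  shows "minmax_image U \<le>\<^sub>T U"
  unfolding tukey_le_def
proof (intro exI[of _ "(`) minmax"] conjI ballI allI impI)
  have image: "minmax ` A \<in> minmax_image U" if "A \<in> U" for A
  proof -
    have "A \<subseteq> {s \<in> FIN. minmax s \<in> minmax ` A}"
      using ultrafilter_on_subset[OF U that] by auto
    then have "{s \<in> FIN. minmax s \<in> minmax ` A} \<in> U"
      by (rule ultrafilter_on_superset[OF U that]) auto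
    then show ?thesis unfolding minmax_image_def by simp
  qed
  then show "minmax ` A \<in> minmax_image U" if "A \<in> U" for A using that .
  fix B assume B: "filter_base_of U B"
  show "filter_base_of (minmax_image U) ((`) minmax ` B)"
    unfolding filter_base_of_def
  proof (intro conjI ballI)
    show "(`) minmax ` B \<subseteq> minmax_image U"
      using B image unfolding filter_base_of_def by auto
  next
    fix Y assume "Y \<in> minmax_image U"
    then obtain C where "C \<in> B" "C \<subseteq> {s \<in> FIN. minmax s \<in> Y}"
      using B unfolding filter_base_of_def minmax_image_def by auto
    then show "\<exists>C\<in>(`) minmax ` B. C \<subseteq> Y" by auto
  qed
qed

section \<open>Block sequences\<close>

lemma FIN_mem_bounds: "s \<in> FIN \<Longrightarrow> x \<in> s \<Longrightarrow> Min s \<le> x \<and> x \<le> Max s"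
  unfolding FIN_def by auto

lemma FIN_Min_Max_in: "s \<in> FIN \<Longrightarrow> Min s \<in> s \<and> Max s \<in> s"
  unfolding FIN_def by auto

lemma FIN_Min_le_Max: "s \<in> FIN \<Longrightarrow> Min s \<le> Max s"
  unfolding FIN_def by auto

lemma FIN_union: "a \<in> FIN \<Longrightarrow> b \<in> FIN \<Longrightarrow> a \<union> b \<in> FIN"
  unfolding FIN_def by auto

lemma Min_Max_ordered_union:
  fixes a b :: "nat set"
  assumes "a \<in> FIN" "b \<in> FIN" "Max a < Min b"
  shows "Min (a \<union> b) = Min a" "Max (a \<union> b) = Max b"
proof -
  have *: "Min a \<le> Max a" "Min b \<le> Max b" using FIN_Min_le_Max assms by blast+
  have "Min (a \<union> b) = min (Min a) (Min b)" "Max (a \<union> b) = max (Max a) (Max b)"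
    using assms unfolding FIN_def by (auto simp: Min_Un Max_Un)
  then show "Min (a \<union> b) = Min a" "Max (a \<union> b) = Max b" using * assms(3) by auto
qed

lemma block_in_FIN: "X \<in> block_sequences \<Longrightarrow> X i \<in> FIN"
  unfolding block_sequences_def by blast

lemma block_less:
  assumes "X \<in> block_sequences" "i < j"
  shows "Max (X i) < Min (X j)"
  using assms(2)
proof (induction j)
  case (Suc j)
  have "Max (X j) < Min (X (Suc j))" using assms(1) unfolding block_sequences_def by blast
  moreover have "Min (X j) \<le> Max (X j)"
    by (rule FIN_Min_le_Max[OF block_in_FIN[OF assms(1)]])
  ultimately show ?case using Suc by (cases "i = j") auto
qed simp

lemma block_Max_mono:
  assumes "X \<in> block_sequences" "i \<le> j"
  shows "Max (X i) \<le> Max (X j)"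
proof (cases "i = j")
  case False
  then show ?thesis
    using block_less[OF assms(1), of i j] FIN_Min_le_Max[OF block_in_FIN[OF assms(1)], of j] assms(2)
    by simp
qed simp

lemma block_Min_ge:
  assumes "X \<in> block_sequences"
  shows "i \<le> Min (X i)"
proof (induction i)
  case (Suc i)
  have "Min (X i) \<le> Max (X i)"
    by (rule FIN_Min_le_Max[OF block_in_FIN[OF assms]])
  then show ?case using block_less[OF assms, of i "Suc i"] Suc by simp
qed simp

lemma block_disjoint:
  assumes "X \<in> block_sequences" "x \<in> X i" "x \<in> X j"
  shows "i = j"
proof (rule ccontr)
  assume "i \<noteq> j"
  then have "Max (X i) < Min (X j) \<or> Max (X j) < Min (X i)"
    using block_less[OF assms(1)] by (cases i j rule: linorder_cases) auto
  moreover have "Min (X i) \<le> x" "x \<le> Max (X i)" "Min (X j) \<le> x" "x \<le> Max (X j)"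
    using FIN_mem_bounds block_in_FIN[OF assms(1)] assms(2,3) by blast+
  ultimately show False by linarith
qed

lemma block_span_FIN:
  assumes "X \<in> block_sequences" "s \<in> block_span X"
  shows "s \<in> FIN"
  using assms(2) block_in_FIN[OF assms(1)] unfolding block_span_def FIN_def by blast

lemma block_in_span: "X i \<in> block_span X"
  unfolding block_span_def by (auto intro!: exI[of _ "{i}"])

lemma block_span_union:
  assumes "a \<in> block_span X" "b \<in> block_span X"
  shows "a \<union> b \<in> block_span X"
proof -
  obtain F G where "finite F" "F \<noteq> {}" "a = \<Union>(X ` F)" "finite G" "G \<noteq> {}" "b = \<Union>(X ` G)"
    using assms unfolding block_span_def by auto
  then have "a \<union> b = \<Union>(X ` (F \<union> G))" "finite (F \<union> G)" "F \<union> G \<noteq> {}" by auto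
  then show ?thesis unfolding block_span_def by blast
qed

lemma block_span_Union:
  assumes "finite F" "F \<noteq> {}" "\<And>i. i \<in> F \<Longrightarrow> Y i \<in> block_span X"
  shows "(\<Union>i\<in>F. Y i) \<in> block_span X"
  using assms by (induction F rule: finite_ne_induct) (auto intro: block_span_union)

lemma block_span_Min_Max:
  assumes "X \<in> block_sequences" "s \<in> block_span X"
  obtains i j where "Min s = Min (X i)" "Max s = Max (X j)"
proof -
  obtain F where F: "s = \<Union>(X ` F)" using assms unfolding block_span_def by blast
  have s: "s \<in> FIN" by (rule block_span_FIN[OF assms])
  then obtain i j where i: "i \<in> F" "Min s \<in> X i" and j: "j \<in> F" "Max s \<in> X j"
    using FIN_Min_Max_in F by blast
  have "X i \<subseteq> s" "X j \<subseteq> s" using F i j by auto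
  then have "Min s = Min (X i)" "Max s = Max (X j)"
    using i j FIN_mem_bounds FIN_Min_Max_in s block_in_FIN[OF assms(1)] by (meson order_antisym subsetD)+
  then show ?thesis using that by blast
qed

lemma block_almost_le_if_span_subset:
  "block_span X \<subseteq> block_span Y \<Longrightarrow> block_almost_le X Y"
  unfolding block_almost_le_def block_le_def block_tail_def using block_in_span by blast

text \<open>
  What almost-inclusion gives for whole spans: a union of blocks whose minimum is large uses only
  blocks of the tail.
\<close>

lemma block_almost_le_span:
  assumes "X \<in> block_sequences" "block_almost_le X Y"
  obtains n where "\<And>s. s \<in> block_span X \<Longrightarrow> n < Min s \<Longrightarrow> s \<in> block_span Y"
proof -
  obtain n where n: "\<And>i. block_tail X n i \<in> block_span Y"
    using assms unfolding block_almost_le_def block_le_def by blast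
  have tail: "X i \<in> block_span Y" if "n < Min (X i)" for i
  proof -
    have "(LEAST i0. n < Min (X i0)) \<le> i" using that by (rule Least_le)
    then show ?thesis
      using n[of "i - (LEAST i0. n < Min (X i0))"] unfolding block_tail_def by simp
  qed
  show ?thesis
  proof
    fix s assume s: "s \<in> block_span X" "n < Min s"
    then obtain F where F: "s = \<Union>(X ` F)" "finite F" "F \<noteq> {}"
      unfolding block_span_def by blast
    have "n < Min (X i)" if "i \<in> F" for i
    proof -
      have "Min (X i) \<in> s" using F that FIN_Min_Max_in block_in_FIN[OF assms(1)] by blast
      then show ?thesis using FIN_mem_bounds block_span_FIN[OF assms(1)] s by fastforce
    qed
    then show "s \<in> block_span Y"
      using block_span_Union[OF F(2,3)] tail F(1) by simp
  qed
qed

section \<open>Diagonalization in stable ordered-union ultrafilters\<close>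

lemma ordered_union_ultrafilter: "ordered_union U \<Longrightarrow> ultrafilter_on FIN U"
  unfolding ordered_union_def by blast

lemma ordered_union_block:
  assumes "ordered_union U" "A \<in> U"
  obtains X where "X \<in> block_sequences" "block_span X \<in> U" "block_span X \<subseteq> A"
proof -
  obtain B where B: "filter_base_of U B" "\<forall>A\<in>B. \<exists>X\<in>block_sequences. A = block_span X"
    using assms(1) unfolding ordered_union_def by blast
  then obtain C where "C \<in> B" "C \<subseteq> A" "C \<in> U"
    using assms(2) unfolding filter_base_of_def by blast
  then show ?thesis using B(2) that by metis
qed

lemma ordered_union_Min_greater:
  assumes "ordered_union U"
  shows "{s \<in> FIN. n < Min s} \<in> U"
proof -
  have U: "ultrafilter_on FIN U" by (rule ordered_union_ultrafilter[OF assms])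
  obtain A where A: "A \<in> U" "(\<forall>s\<in>A. n < Min s) \<or> (\<forall>s\<in>A. \<not> n < Min s)"
    using ultrafilter_on_homogeneous[OF U] by blast
  obtain X where X: "X \<in> block_sequences" "block_span X \<in> U" "block_span X \<subseteq> A"
    using ordered_union_block[OF assms A(1)] .
  have "n < Min (X (Suc n))" using block_Min_ge[OF X(1), of "Suc n"] by simp
  then have "\<forall>s\<in>A. n < Min s" using A(2) X(3) block_in_span by blast
  then have "A \<subseteq> {s \<in> FIN. n < Min s}" using ultrafilter_on_subset[OF U A(1)] by blast
  then show ?thesis using ultrafilter_on_superset[OF U A(1)] by blast
qed

text \<open>
  The points \<open>x\<close> of \<open>s\<close>, other than its maximum, whose successor in \<open>s\<close> exceeds \<open>f x\<close>.
\<close>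

definition gaps :: "(nat \<Rightarrow> nat) \<Rightarrow> nat set \<Rightarrow> nat set" where
  "gaps f s = {x \<in> s. (\<exists>y\<in>s. x < y) \<and> (\<forall>y\<in>s. x < y \<longrightarrow> f x < y)}"

lemma gaps_union:
  assumes a: "a \<in> FIN" and b: "b \<in> FIN" and ab: "Max a < Min b"
  shows "card (gaps f (a \<union> b)) =
    card (gaps f a) + card (gaps f b) + (if f (Max a) < Min b then 1 else 0)"
proof -
  have Max_a: "y \<le> Max a" if "y \<in> a" for y using FIN_mem_bounds[OF a that] by simp
  have Max_a_in: "Max a \<in> a" using FIN_Min_Max_in[OF a] by simp
  have lt: "x < y" if "x \<in> a" "y \<in> b" for x y
    using FIN_mem_bounds[OF a that(1)] FIN_mem_bounds[OF b that(2)] ab by linarith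
  have fin: "finite (gaps f a)" "finite (gaps f b)"
    using a b unfolding gaps_def FIN_def by auto
  have no_gap: "Max a \<notin> gaps f a" "Max a \<notin> gaps f b" "gaps f a \<inter> gaps f b = {}"
    using Max_a lt[OF Max_a_in] lt unfolding gaps_def by (auto simp: not_less[symmetric])
  have Max_gap: "Max a \<in> gaps f (a \<union> b) \<longleftrightarrow> f (Max a) < Min b"
  proof -
    have "(\<forall>y\<in>b. f (Max a) < y) \<longleftrightarrow> f (Max a) < Min b" "\<exists>y. y \<in> b"
      using b unfolding FIN_def by auto
    moreover have "\<not> Max a < y" if "y \<in> a" for y using Max_a[OF that] by simp
    ultimately show ?thesis
      using Max_a_in lt[OF Max_a_in] unfolding gaps_def by auto
  qed
  have b_gap: "x \<in> gaps f (a \<union> b) \<longleftrightarrow> x \<in> gaps f b" if "x \<in> b" for x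
  proof -
    have "\<not> x < y" if "y \<in> a" for y using lt[OF that \<open>x \<in> b\<close>] by simp
    then show ?thesis using that unfolding gaps_def by auto
  qed
  have a_gap: "x \<in> gaps f (a \<union> b) \<longleftrightarrow> x \<in> gaps f a" if "x \<in> a" "x \<noteq> Max a" for x
  proof -
    have "x < Max a" using Max_a[OF that(1)] that(2) by simp
    \<comment> \<open>The points of \<open>b\<close> lie beyond \<open>Max a\<close>, so they impose no further condition.\<close>
    moreover have "f x < y" if "f x < Max a" "y \<in> b" for y
      using lt[OF Max_a_in that(2)] that(1) by simp
    ultimately show ?thesis using that Max_a_in unfolding gaps_def by auto
  qed
  have sub: "x \<in> s" if "x \<in> gaps f s" for x s using that unfolding gaps_def by blast
  have "gaps f (a \<union> b) = gaps f a \<union> gaps f b \<union> (if f (Max a) < Min b then {Max a} else {})"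
  proof (rule set_eqI)
    fix x
    have "x \<notin> gaps f b" if "x \<in> a" using sub[of x b] lt[OF that] by auto
    moreover have "x \<notin> gaps f a" if "x \<in> b" using sub[of x a] lt[OF _ that] by auto
    ultimately show "x \<in> gaps f (a \<union> b) \<longleftrightarrow>
        x \<in> gaps f a \<union> gaps f b \<union> (if f (Max a) < Min b then {Max a} else {})"
      using a_gap[of x] b_gap[of x] Max_gap no_gap(1) Max_a_in sub[of x a] sub[of x b] sub[of x "a \<union> b"]
      by (cases "x = Max a"; cases "x \<in> a"; cases "x \<in> b") auto
  qed
  then show ?thesis using no_gap fin by (auto simp: card_Un_disjoint)
qed

text \<open>
  An ordered-union ultrafilter concentrates on arbitrarily sparse sets. Let the parity of the number
  of gaps be constant on \<open>[X] \<in> U\<close>. By \<open>gaps_union\<close>, for \<open>a < b\<close> in \<open>[X]\<close> there is a gap between \<open>a\<close> and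
  \<open>b\<close> exactly if this parity is odd, so the answer is the same for all such pairs; and it is positive
  once \<open>b\<close> is far away.
\<close>

lemma ordered_union_sparse:
  assumes "ordered_union U"
  obtains S where "S \<in> U" "\<And>a b. a \<in> S \<Longrightarrow> b \<in> S \<Longrightarrow> Max a < Min b \<Longrightarrow> f (Max a) < Min b"
proof -
  have U: "ultrafilter_on FIN U" by (rule ordered_union_ultrafilter[OF assms])
  obtain A where A: "A \<in> U"
    "(\<forall>s\<in>A. even (card (gaps f s))) \<or> (\<forall>s\<in>A. \<not> even (card (gaps f s)))"
    using ultrafilter_on_homogeneous[OF U] by blast
  obtain X where X: "X \<in> block_sequences" "block_span X \<in> U" "block_span X \<subseteq> A"
    using ordered_union_block[OF assms A(1)] .
  note fin = block_span_FIN[OF X(1)]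
  have step: "f (Max a) < Min b \<longleftrightarrow> odd (card (gaps f a))"
    if "a \<in> block_span X" "b \<in> block_span X" "Max a < Min b" for a b
  proof -
    have "even (card (gaps f a)) = even (card (gaps f b))"
      "even (card (gaps f a)) = even (card (gaps f (a \<union> b)))"
      using A(2) X(3) that block_span_union[OF that(1,2)] by blast+
    moreover have "even (card (gaps f (a \<union> b))) \<longleftrightarrow>
        (even (card (gaps f a)) \<longleftrightarrow> even (card (gaps f b))) \<noteq> (f (Max a) < Min b)"
      using gaps_union[OF fin[OF that(1)] fin[OF that(2)] that(3), of f] by simp
    ultimately show ?thesis by argo
  qed
  show ?thesis
  proof (rule that[OF X(2)])
    fix a b assume ab: "a \<in> block_span X" "b \<in> block_span X" "Max a < Min b"
    \<comment> \<open>The block \<open>X k\<close> is far enough from \<open>a\<close> to leave a gap.\<close>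
    define k where "k = Suc (max (f (Max a)) (Max a))"
    have "f (Max a) < Min (X k)" "Max a < Min (X k)"
      using block_Min_ge[OF X(1), of k] unfolding k_def by auto
    then have "odd (card (gaps f a))" using step[OF ab(1) block_in_span] by blast
    then show "f (Max a) < Min b" using step[OF ab] by blast
  qed
qed

text \<open>
  Stability alone provides a pseudo-intersection \<open>Z\<close> of the \<open>D n\<close>, with \<open>b \<in> D n\<close> only for
  \<open>Min b > f n\<close>. Intersecting with a set that is sparse for this \<open>f\<close> turns it into a diagonal
  intersection.
\<close>

lemma stable_ordered_union_diagonal:
  assumes "stable_ordered_union U" and D: "\<And>n. D n \<in> U"
  obtains Y where "Y \<in> block_sequences" "block_span Y \<in> U"
    "\<forall>a\<in>block_span Y. \<forall>b\<in>block_span Y. Max a < Min b \<longrightarrow> b \<in> D (Max a)"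
proof -
  have ou: "ordered_union U" using assms(1) unfolding stable_ordered_union_def by blast
  have U: "ultrafilter_on FIN U" by (rule ordered_union_ultrafilter[OF ou])
  let ?P = "\<lambda>n X. X \<in> block_sequences \<and> block_span X \<in> U \<and> block_span X \<subseteq> D n"
  have "\<exists>X. \<forall>n. ?P n (X n) \<and> block_span (X (Suc n)) \<subseteq> block_span (X n)"
  proof (rule dependent_nat_choice)
    show "\<exists>X. ?P 0 X" using ordered_union_block[OF ou D] by metis
  next
    fix X n assume "?P n X"
    then have "block_span X \<inter> D (Suc n) \<in> U" using ultrafilter_on_Int[OF U] D by blast
    then show "\<exists>X'. ?P (Suc n) X' \<and> block_span X' \<subseteq> block_span X"
      using ordered_union_block[OF ou] by (metis le_inf_iff)
  qed
  then obtain X where X: "\<And>n. ?P n (X n)" "\<And>n. block_span (X (Suc n)) \<subseteq> block_span (X n)"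
    by blast
  then obtain Z where Z: "Z \<in> block_sequences" "block_span Z \<in> U" "\<And>n. block_almost_le Z (X n)"
    using assms(1) block_almost_le_if_span_subset unfolding stable_ordered_union_def by metis
  have "\<exists>m. \<forall>s\<in>block_span Z. m < Min s \<longrightarrow> s \<in> D n" for n
    using block_almost_le_span[OF Z(1) Z(3)] X(1) by (metis subsetD)
  then obtain f where f: "\<And>n s. s \<in> block_span Z \<Longrightarrow> f n < Min s \<Longrightarrow> s \<in> D n" by metis
  obtain S where S: "S \<in> U" "\<And>a b. a \<in> S \<Longrightarrow> b \<in> S \<Longrightarrow> Max a < Min b \<Longrightarrow> f (Max a) < Min b"
    using ordered_union_sparse[OF ou] by metis
  obtain Y where Y: "Y \<in> block_sequences" "block_span Y \<in> U" "block_span Y \<subseteq> S \<inter> block_span Z"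
    using ordered_union_block[OF ou ultrafilter_on_Int[OF U S(1) Z(2)]] .
  show ?thesis
    using that[OF Y(1,2)] f S(2) Y(3) by blast
qed

section \<open>Functions of the minima and the maxima\<close>

text \<open>
  A block sequence \<open>X\<close> has \<open>(a, b) = minmax (X i \<union> X j)\<close> for any minimum \<open>a\<close> and maximum \<open>b\<close> of
  blocks with \<open>a \<le> b\<close>. So the minmax image of \<open>[X]\<close> is determined by the set of minima and the set
  of maxima, and a reduction may be regarded as a function of these two sets.
\<close>

lemma tukey_le_minmax_image_reduction:
  assumes "U \<le>\<^sub>T minmax_image U" and ou: "ordered_union U"
  obtains H where
    "\<And>A B S. S \<in> U \<Longrightarrow> Min ` S \<subseteq> A \<Longrightarrow> Max ` S \<subseteq> B \<Longrightarrow> H A B \<in> U"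
    "\<And>A B A' B'. A \<subseteq> A' \<Longrightarrow> B \<subseteq> B' \<Longrightarrow> H A B \<subseteq> H A' B'"
    "\<And>T. T \<in> U \<Longrightarrow> \<exists>S\<in>U. H (Min ` S) (Max ` S) \<subseteq> T"
proof -
  have U: "ultrafilter_on FIN U" by (rule ordered_union_ultrafilter[OF ou])
  obtain g where g: "\<forall>W\<in>minmax_image U. g W \<in> U" "mono g"
    "\<forall>T\<in>U. \<exists>W\<in>minmax_image U. g W \<subseteq> T"
    using tukey_le_monotone_cofinal[OF assms(1) U] .
  define R where "R A B = {(a, b). a \<in> A \<and> b \<in> B \<and> a \<le> b}" for A B :: "nat set"
  show ?thesis
  proof (rule that[of "\<lambda>A B. g (R A B)"])
    fix S and A B :: "nat set" assume S: "S \<in> U" "Min ` S \<subseteq> A" "Max ` S \<subseteq> B"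
    have "S \<subseteq> {s \<in> FIN. minmax s \<in> R A B}"
    proof
      fix s assume "s \<in> S"
      then have "s \<in> FIN" using ultrafilter_on_subset[OF U S(1)] by blast
      moreover have "Min s \<le> Max s" by (rule FIN_Min_le_Max[OF \<open>s \<in> FIN\<close>])
      ultimately show "s \<in> {s \<in> FIN. minmax s \<in> R A B}"
        using S \<open>s \<in> S\<close> unfolding minmax_def R_def by auto
    qed
    then have "R A B \<in> minmax_image U"
      unfolding minmax_image_def using ultrafilter_on_superset[OF U S(1)] by blast
    then show "g (R A B) \<in> U" using g(1) by simp
  next
    fix A B A' B' :: "nat set" assume "A \<subseteq> A'" "B \<subseteq> B'"
    then have "R A B \<subseteq> R A' B'" unfolding R_def by blast
    then show "g (R A B) \<subseteq> g (R A' B')" by (rule monoD[OF g(2)])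
  next
    fix T assume "T \<in> U"
    then obtain W where W: "W \<in> minmax_image U" "g W \<subseteq> T" using g(3) by blast
    obtain X where X: "X \<in> block_sequences" "block_span X \<in> U"
        "block_span X \<subseteq> {s \<in> FIN. minmax s \<in> W}"
      using ordered_union_block[OF ou] W(1) unfolding minmax_image_def by blast
    have "R (Min ` block_span X) (Max ` block_span X) \<subseteq> W"
    proof
      fix w assume "w \<in> R (Min ` block_span X) (Max ` block_span X)"
      then obtain s s' where s: "s \<in> block_span X" "s' \<in> block_span X"
        "w = (Min s, Max s')" "Min s \<le> Max s'" unfolding R_def by blast
      obtain i where i: "Min s = Min (X i)" using block_span_Min_Max[OF X(1) s(1)] by blast
      obtain j where j: "Max s' = Max (X j)" using block_span_Min_Max[OF X(1) s(2)] by blast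
      have "i \<le> j" by (rule leI) (use block_less[OF X(1), of j i] s(4) i j in auto)
      then have "minmax (X i \<union> X j) = w"
        using Min_Max_ordered_union[OF block_in_FIN[OF X(1)] block_in_FIN[OF X(1)] block_less[OF X(1)], of i j] i j s(3)
        unfolding minmax_def by (cases "i = j") auto
      then show "w \<in> W" using X(3) block_span_union[OF block_in_span block_in_span] by blast
    qed
    then have "g (R (Min ` block_span X) (Max ` block_span X)) \<subseteq> g W" by (rule monoD[OF g(2)])
    then show "\<exists>S\<in>U. g (R (Min ` S) (Max ` S)) \<subseteq> T" using X(2) W(2) by (meson order_trans)
  qed
qed

section \<open>Parity of the number of blocks\<close>

definition block_count :: "(nat \<Rightarrow> nat set) \<Rightarrow> nat set \<Rightarrow> nat" where
  "block_count Y t = card {i. Y i \<subseteq> t}"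

lemma block_count_union_block:
  assumes Y: "Y \<in> block_sequences" and t: "finite t" "t \<inter> Y j = {}"
  shows "block_count Y (t \<union> Y j) = Suc (block_count Y t)"
proof -
  have ne: "Y i \<noteq> {}" for i using block_in_FIN[OF Y] unfolding FIN_def by blast
  have "Y i \<subseteq> t" if "Y i \<subseteq> t \<union> Y j" "i \<noteq> j" for i
    using that block_disjoint[OF Y] by blast
  then have eq: "{i. Y i \<subseteq> t \<union> Y j} = insert j {i. Y i \<subseteq> t}" by blast
  have "i \<in> {..Max t}" if "Y i \<subseteq> t" for i
  proof -
    have "Min (Y i) \<in> t" using FIN_Min_Max_in[OF block_in_FIN[OF Y]] that by blast
    then have "Min (Y i) \<le> Max t" using t(1) by simp
    then show ?thesis using block_Min_ge[OF Y, of i] by simp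
  qed
  then have "finite {i. Y i \<subseteq> t}" by (blast intro: finite_subset[OF _ finite_atMost])
  moreover have "j \<notin> {i. Y i \<subseteq> t}" using t(2) ne[of j] by blast
  ultimately show ?thesis unfolding block_count_def eq by simp
qed

text \<open>
  Almost every \<open>z\<close> skips a block of \<open>Y\<close> in its interior: for \<open>[X] \<in> U\<close> inside \<open>[Y]\<close>, the set
  \<open>X 0 \<union> X 2\<close> skips all blocks making up \<open>X 1\<close>, so the sets that skip nothing cannot contain \<open>[X]\<close>.
\<close>

lemma ordered_union_skipping:
  assumes ou: "ordered_union U" and Y: "Y \<in> block_sequences" "block_span Y \<in> U"
  obtains Q where "Q \<in> U" "\<forall>z\<in>Q.
    \<exists>a\<in>block_span Y. \<exists>c\<in>block_span Y. \<exists>j. Max a < Min (Y j) \<and> Max (Y j) < Min c \<and> z = a \<union> c"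
proof -
  let ?P = "\<lambda>z. \<exists>a\<in>block_span Y. \<exists>c\<in>block_span Y. \<exists>j.
    Max a < Min (Y j) \<and> Max (Y j) < Min c \<and> z = a \<union> c"
  have U: "ultrafilter_on FIN U" by (rule ordered_union_ultrafilter[OF ou])
  obtain Q where Q: "Q \<in> U" "(\<forall>z\<in>Q. ?P z) \<or> (\<forall>z\<in>Q. \<not> ?P z)"
    using ultrafilter_on_homogeneous[OF U, of ?P] by metis
  obtain X where X: "X \<in> block_sequences" "block_span X \<in> U" "block_span X \<subseteq> Q \<inter> block_span Y"
    using ordered_union_block[OF ou ultrafilter_on_Int[OF U Q(1) Y(2)]] .
  have XY: "X i \<in> block_span Y" for i using X(3) block_in_span by blast
  then have "X 1 \<in> block_span Y" .
  then obtain F j where "X 1 = \<Union>(Y ` F)" "j \<in> F" unfolding block_span_def by auto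
  then have j: "Y j \<subseteq> X 1" by blast
  have "Min (X 1) \<le> Min (Y j)" "Max (Y j) \<le> Max (X 1)"
    using j FIN_mem_bounds[OF block_in_FIN[OF X(1)]] FIN_Min_Max_in[OF block_in_FIN[OF Y(1)]] by blast+
  then have "Max (X 0) < Min (Y j)" "Max (Y j) < Min (X 2)"
    using block_less[OF X(1), of 0 1] block_less[OF X(1), of 1 2] by simp_all
  then have "?P (X 0 \<union> X 2)" using XY by blast
  moreover have "X 0 \<union> X 2 \<in> Q" using X(3) block_span_union[OF block_in_span block_in_span] by blast
  ultimately show ?thesis using that[OF Q(1)] Q(2) by blast
qed

section \<open>Forcing with finite stems of end points\<close>

text \<open>
  The hypothetical situation to be refuted: a monotone cofinal map into \<open>U\<close> that depends only on a set
  of minima and a set of maxima.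
\<close>

locale minmax_cofinal_map =
  fixes U :: "nat set set set" and H :: "nat set \<Rightarrow> nat set \<Rightarrow> nat set set"
  assumes stable: "stable_ordered_union U"
    and H_large: "\<And>A B S. S \<in> U \<Longrightarrow> Min ` S \<subseteq> A \<Longrightarrow> Max ` S \<subseteq> B \<Longrightarrow> H A B \<in> U"
    and H_mono: "\<And>A B A' B'. A \<subseteq> A' \<Longrightarrow> B \<subseteq> B' \<Longrightarrow> H A B \<subseteq> H A' B'"
    and H_cofinal: "\<And>T. T \<in> U \<Longrightarrow> \<exists>S\<in>U. H (Min ` S) (Max ` S) \<subseteq> T"
begin

lemma ordered: "ordered_union U"
  using stable unfolding stable_ordered_union_def by blast

lemma ultra: "ultrafilter_on FIN U"
  by (rule ordered_union_ultrafilter[OF ordered])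

text \<open>
  A finite stem of minima \<open>p\<close> and maxima \<open>q\<close> forces \<open>t\<close> if \<open>t\<close> remains in the value of \<open>H\<close> however
  small the tail added to the stem.
\<close>

definition forced :: "nat set \<Rightarrow> nat set \<Rightarrow> nat set \<Rightarrow> bool" where
  "forced p q t \<longleftrightarrow> (\<forall>S\<in>U. t \<in> H (p \<union> Min ` S) (q \<union> Max ` S))"

definition forces :: "nat set \<Rightarrow> nat set \<Rightarrow> nat set \<Rightarrow> nat set \<Rightarrow> bool" where
  "forces p q r z \<longleftrightarrow> forced (insert (Min z) p) (insert (Max z) q) (r \<union> z)"

definition beyond :: "(nat \<Rightarrow> nat set) \<Rightarrow> nat \<Rightarrow> nat set set" where
  "beyond Y n = {b \<in> block_span Y. n < Min b}"

text \<open>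
  The first clause is continuity of \<open>H\<close>: what belongs to its value for the largest tail available above
  a stem belongs to it for every tail. The second clause says that the truth of \<open>forces p q r z\<close> does not
  depend on \<open>z\<close>.
\<close>

definition decisive :: "(nat \<Rightarrow> nat set) \<Rightarrow> bool" where
  "decisive Y \<longleftrightarrow> Y \<in> block_sequences \<and> block_span Y \<in> U \<and>
    (\<forall>a\<in>block_span Y. \<forall>p\<subseteq>{..Max a}. \<forall>q\<subseteq>{..Max a}. \<forall>r\<subseteq>{..Max a}.
      (r \<in> H (p \<union> Min ` beyond Y (Max a)) (q \<union> Max ` beyond Y (Max a)) \<longrightarrow> forced p q r) \<and>
      (\<forall>b\<in>beyond Y (Max a). \<forall>c\<in>beyond Y (Max a). forces p q r b \<longrightarrow> forces p q r c))"

text \<open>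
  Each instance of either clause holds on some member of \<open>U\<close>: a tail witnessing that \<open>r\<close> is not
  forced, or a homogeneous set for \<open>forces p q r\<close>. Only finitely many \<open>p, q, r\<close> lie below a given
  bound, so one diagonalization handles all of them.
\<close>

lemma ex_decisive: "\<exists>Y. decisive Y"
proof -
  have "\<exists>S\<in>U. forced p q t \<or> t \<notin> H (p \<union> Min ` S) (q \<union> Max ` S)" for p q t
  proof (cases "forced p q t")
    case True
    have "FIN \<in> U" using ultra unfolding ultrafilter_on_def by simp
    then show ?thesis using True by auto
  next
    case False
    then show ?thesis unfolding forced_def by auto
  qed
  then obtain L where L: "\<And>p q t. L p q t \<in> U"
    "\<And>p q t. forced p q t \<or> t \<notin> H (p \<union> Min ` L p q t) (q \<union> Max ` L p q t)" by metis
  have "\<exists>S\<in>U. (\<forall>z\<in>S. forces p q r z) \<or> (\<forall>z\<in>S. \<not> forces p q r z)" for p q r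
    by (rule ultrafilter_on_homogeneous[OF ultra, of "forces p q r"]) auto
  then obtain M where M: "\<And>p q r. M p q r \<in> U"
    "\<And>p q r. (\<forall>z\<in>M p q r. forces p q r z) \<or> (\<forall>z\<in>M p q r. \<not> forces p q r z)" by metis
  define D where
    "D n = (\<Inter>p\<in>Pow {..n}. \<Inter>q\<in>Pow {..n}. \<Inter>r\<in>Pow {..n}. L p q r \<inter> M p q r)" for n :: nat
  have "D n \<in> U" for n
    unfolding D_def
    by (intro ultrafilter_on_finite_INT[OF ultra] ultrafilter_on_Int[OF ultra] L(1) M(1)) auto
  then obtain Y where Y: "Y \<in> block_sequences" "block_span Y \<in> U"
    and diag: "\<forall>a\<in>block_span Y. \<forall>b\<in>block_span Y. Max a < Min b \<longrightarrow> b \<in> D (Max a)"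
    by (rule stable_ordered_union_diagonal[OF stable])
  have "(r \<in> H (p \<union> Min ` beyond Y (Max a)) (q \<union> Max ` beyond Y (Max a)) \<longrightarrow> forced p q r) \<and>
      (\<forall>b\<in>beyond Y (Max a). \<forall>c\<in>beyond Y (Max a). forces p q r b \<longrightarrow> forces p q r c)"
    if a: "a \<in> block_span Y" and pqr: "p \<subseteq> {..Max a}" "q \<subseteq> {..Max a}" "r \<subseteq> {..Max a}" for a p q r
  proof -
    have "beyond Y (Max a) \<subseteq> D (Max a)" using diag a unfolding beyond_def by auto
    also have "D (Max a) \<subseteq> L p q r \<inter> M p q r"
      using pqr unfolding D_def by (intro INF_lower2[of p] INF_lower2[of q] INF_lower[of r]) auto
    finally have sub: "beyond Y (Max a) \<subseteq> L p q r" "beyond Y (Max a) \<subseteq> M p q r" by auto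
    have "H (p \<union> Min ` beyond Y (Max a)) (q \<union> Max ` beyond Y (Max a))
        \<subseteq> H (p \<union> Min ` L p q r) (q \<union> Max ` L p q r)"
      using sub(1) by (intro H_mono Un_mono image_mono order_refl)
    then show ?thesis using L(2)[of p q r] M(2)[of p q r] sub(2) by auto
  qed
  then have "decisive Y" using Y unfolding decisive_def by simp
  then show ?thesis by blast
qed

text \<open>
  Every block of \<open>Z\<close> after \<open>Z m\<close> lies in \<open>beyond Y (Max (Z m))\<close>, so \<open>Z\<close> has no more end points than the
  stem of its first blocks together with this largest tail, and continuity applies.
\<close>

lemma forced_by_initial_blocks:
  assumes Y: "decisive Y" and Z: "Z \<in> block_sequences" "block_span Z \<subseteq> block_span Y"
    and t: "t \<in> H (Min ` block_span Z) (Max ` block_span Z)" "t \<subseteq> {..Max (Z m)}"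
  shows "forced ((\<lambda>i. Min (Z i)) ` {..m}) ((\<lambda>i. Max (Z i)) ` {..m}) t"
proof -
  let ?p = "(\<lambda>i. Min (Z i)) ` {..m}" and ?q = "(\<lambda>i. Max (Z i)) ` {..m}"
  let ?tail = "beyond Y (Max (Z m))"
  have ZY: "Z i \<in> block_span Y" for i using Z(2) block_in_span by blast
  note mM = FIN_Min_le_Max[OF block_in_FIN[OF Z(1)]]
  note Max_le = block_Max_mono[OF Z(1)]
  have "?q \<subseteq> {..Max (Z m)}" using Max_le by auto
  moreover have "?p \<subseteq> {..Max (Z m)}" using Max_le mM order_trans by fastforce
  moreover have tail: "Z i \<in> ?tail" if "m < i" for i
    using block_less[OF Z(1) that] ZY unfolding beyond_def by simp
  have "Min ` block_span Z \<subseteq> ?p \<union> Min ` ?tail"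
  proof
    fix x assume "x \<in> Min ` block_span Z"
    then obtain i where "x = Min (Z i)" using block_span_Min_Max[OF Z(1)] by (metis imageE)
    then show "x \<in> ?p \<union> Min ` ?tail" using tail[of i] by (cases "i \<le> m") auto
  qed
  moreover have "Max ` block_span Z \<subseteq> ?q \<union> Max ` ?tail"
  proof
    fix x assume "x \<in> Max ` block_span Z"
    then obtain i where "x = Max (Z i)" using block_span_Min_Max[OF Z(1)] by (metis imageE)
    then show "x \<in> ?q \<union> Max ` ?tail" using tail[of i] by (cases "i \<le> m") auto
  qed
  ultimately show ?thesis
    using Y ZY[of m] t H_mono unfolding decisive_def by (meson subsetD)
qed

text \<open>
  The end points of \<open>Z 0, \<dots>, Z (Suc n)\<close> force \<open>r \<union> Z (Suc n)\<close>. By homogeneity \<open>r \<union> y\<close> is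
  forced by the stem in which \<open>y\<close> replaces \<open>Z (Suc n)\<close>, and this is the same stem because \<open>y\<close>
  has the same end points.
\<close>

lemma replace_last_block:
  assumes Y: "decisive Y" and Z: "Z \<in> block_sequences" "block_span Z \<in> U" "block_span Z \<subseteq> block_span Y"
    and r: "r \<subseteq> {..Max (Z n)}"
    and t: "r \<union> Z (Suc n) \<in> H (Min ` block_span Z) (Max ` block_span Z)"
    and y: "y \<in> block_span Y" "Min y = Min (Z (Suc n))" "Max y = Max (Z (Suc n))"
  shows "r \<union> y \<in> H (Min ` block_span Z) (Max ` block_span Z)"
proof -
  let ?A = "Min ` block_span Z" and ?B = "Max ` block_span Z" and ?z = "Z (Suc n)"
  define p where "p = (\<lambda>i. Min (Z i)) ` {..n}"
  define q where "q = (\<lambda>i. Max (Z i)) ` {..n}"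
  have ZY: "Z i \<in> block_span Y" for i using Z(3) block_in_span by blast
  note mM = FIN_Min_le_Max[OF block_in_FIN[OF Z(1)]]
  note Max_le = block_Max_mono[OF Z(1)]
  have q: "q \<subseteq> {..Max (Z n)}" using Max_le unfolding q_def by auto
  have p: "p \<subseteq> {..Max (Z n)}" using Max_le mM order_trans unfolding p_def by fastforce
  have nz: "Max (Z n) < Min ?z" by (rule block_less[OF Z(1)]) simp
  have "r \<union> ?z \<subseteq> {..Max ?z}"
  proof -
    have "r \<subseteq> {..Max ?z}" using r nz mM[of "Suc n"] by auto
    moreover have "?z \<subseteq> {..Max ?z}" using FIN_mem_bounds[OF block_in_FIN[OF Z(1)]] by auto
    ultimately show ?thesis by simp
  qed
  from forced_by_initial_blocks[OF Y Z(1,3) t this] have "forces p q r ?z"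
    unfolding forces_def p_def q_def by (simp add: atMost_Suc)
  moreover have "?z \<in> beyond Y (Max (Z n))" "y \<in> beyond Y (Max (Z n))"
    using nz y ZY unfolding beyond_def by auto
  ultimately have "forces p q r y" using Y ZY[of n] p q r unfolding decisive_def by meson
  then have "r \<union> y \<in> H (insert (Min y) p \<union> ?A) (insert (Max y) q \<union> ?B)"
    using Z(2) unfolding forces_def forced_def by simp
  moreover have "insert (Min y) p \<union> ?A = ?A" "insert (Max y) q \<union> ?B = ?B"
    unfolding p_def q_def y using block_in_span[of Z] by auto
  ultimately show ?thesis by (simp only:)
qed

lemma contradiction: False
proof -
  obtain Y where dec: "decisive Y" using ex_decisive ..
  then have Y: "Y \<in> block_sequences" "block_span Y \<in> U" unfolding decisive_def by auto
  note YFIN = block_span_FIN[OF Y(1)]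
  obtain Q where Q: "Q \<in> U" "\<forall>z\<in>Q.
    \<exists>a\<in>block_span Y. \<exists>c\<in>block_span Y. \<exists>j. Max a < Min (Y j) \<and> Max (Y j) < Min c \<and> z = a \<union> c"
    using ordered_union_skipping[OF ordered Y] .
  obtain T where T: "T \<in> U"
    "(\<forall>t\<in>T. even (block_count Y t)) \<or> (\<forall>t\<in>T. \<not> even (block_count Y t))"
    using ultrafilter_on_homogeneous[OF ultra, of "\<lambda>t. even (block_count Y t)"] .
  obtain S where S: "S \<in> U" "H (Min ` S) (Max ` S) \<subseteq> T" using H_cofinal[OF T(1)] by blast
  have "S \<inter> (Q \<inter> block_span Y) \<in> U" by (intro ultrafilter_on_Int[OF ultra] S(1) Q(1) Y(2))
  then obtain Z where Z: "Z \<in> block_sequences" "block_span Z \<in> U"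
    "block_span Z \<subseteq> S \<inter> (Q \<inter> block_span Y)"
    by (rule ordered_union_block[OF ordered])
  let ?A = "Min ` block_span Z" and ?B = "Max ` block_span Z"
  have ZY: "block_span Z \<subseteq> block_span Y" using Z(3) by blast
  note ZFIN = block_in_FIN[OF Z(1)]
  have "H ?A ?B \<subseteq> H (Min ` S) (Max ` S)" using Z(3) by (intro H_mono image_mono) blast+
  then have HT: "H ?A ?B \<subseteq> T" using S(2) by blast
  \<comment> \<open>Starting \<open>t\<close> after \<open>Z 0\<close> guarantees that its last block has a predecessor in \<open>Z\<close>, which bounds
    the stem.\<close>
  have "H ?A ?B \<inter> (block_span Z \<inter> {s \<in> FIN. Max (Z 0) < Min s}) \<in> U"
    by (intro ultrafilter_on_Int[OF ultra] H_large[OF Z(2)] Z(2) ordered_union_Min_greater[OF ordered]) auto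
  then obtain t where t: "t \<in> H ?A ?B" "t \<in> block_span Z" "Max (Z 0) < Min t"
    using ultrafilter_on_nonempty[OF ultra] by blast
  have tFIN: "t \<in> FIN" by (rule block_span_FIN[OF Z(1) t(2)])
  obtain F where F: "t = \<Union>(Z ` F)" "finite F" "F \<noteq> {}" using t(2) unfolding block_span_def by auto
  have "Max F \<noteq> 0"
  proof
    assume "Max F = 0"
    then have "0 \<in> F" using Max_in[OF F(2,3)] by simp
    then have "Max (Z 0) \<in> t" using F(1) FIN_Min_Max_in[OF ZFIN] by blast
    then show False using FIN_mem_bounds[OF tFIN, of "Max (Z 0)"] t(3) by simp
  qed
  then obtain n where n: "Max F = Suc n" using not0_implies_Suc by blast
  then have nF: "Suc n \<in> F" using Max_in[OF F(2,3)] by simp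
  define z where "z = Z (Suc n)"
  define r where "r = \<Union>(Z ` (F - {Suc n}))"
  have trz: "t = r \<union> z" using F(1) nF unfolding r_def z_def by blast
  have nz: "Max (Z n) < Min z" unfolding z_def by (rule block_less[OF Z(1)]) simp
  have r: "x \<le> Max (Z n)" if "x \<in> r" for x
  proof -
    obtain i where i: "i \<in> F" "i \<noteq> Suc n" "x \<in> Z i" using \<open>x \<in> r\<close> unfolding r_def by blast
    then have "i \<le> n" using n Max_ge[OF F(2) i(1)] by simp
    have "x \<le> Max (Z i)" using FIN_mem_bounds[OF ZFIN i(3)] by simp
    also have "\<dots> \<le> Max (Z n)" by (rule block_Max_mono[OF Z(1) \<open>i \<le> n\<close>])
    finally show ?thesis .
  qed
  have "z \<in> Q" using Z(3) block_in_span unfolding z_def by blast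
  then obtain a c j where ac: "a \<in> block_span Y" "c \<in> block_span Y" "Max a < Min (Y j)"
    "Max (Y j) < Min c" "z = a \<union> c" using Q(2) by blast
  \<comment> \<open>Filling in the skipped block \<open>Y j\<close> leaves the end points of \<open>z\<close> unchanged.\<close>
  define y where "y = a \<union> (Y j \<union> c)"
  have a: "a \<in> FIN" and c: "c \<in> FIN" using YFIN ac by auto
  have Yj: "Y j \<in> FIN" by (rule block_in_FIN[OF Y(1)])
  have jc: "Min (Y j \<union> c) = Min (Y j)" "Max (Y j \<union> c) = Max c"
    by (rule Min_Max_ordered_union[OF Yj c ac(4)])+
  have "Min (Y j) \<le> Max (Y j)" by (rule FIN_Min_le_Max[OF Yj])
  then have "Max a < Min c" using ac by linarith
  then have z_ends: "Min z = Min a" "Max z = Max c"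
    unfolding ac(5) by (rule Min_Max_ordered_union[OF a c])+
  have "Max a < Min (Y j \<union> c)" using ac(3) jc by simp
  then have y_ends: "Min y = Min a" "Max y = Max c"
    unfolding y_def using Min_Max_ordered_union[OF a FIN_union[OF Yj c]] jc by simp_all
  have "y \<in> block_span Y" unfolding y_def by (intro block_span_union ac block_in_span)
  then have "r \<union> y \<in> H ?A ?B"
    using replace_last_block[OF dec Z(1,2) ZY, of r n y] r t(1) z_ends y_ends
    unfolding trz z_def by auto
  then have "r \<union> y \<in> T" "t \<in> T" using HT t(1) by auto
  moreover have "block_count Y (r \<union> y) = Suc (block_count Y t)"
  proof -
    have "Min a \<le> Max a" by (rule FIN_Min_le_Max[OF a])
    have "t \<inter> Y j = {}"
    proof (rule equals0I)
      fix x assume x: "x \<in> t \<inter> Y j"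
      then have "Min (Y j) \<le> x" "x \<le> Max (Y j)" using FIN_mem_bounds[OF Yj] by auto
      moreover have "x \<in> r \<or> x \<in> a \<or> x \<in> c" using x unfolding trz ac(5) by blast
      then have "x \<le> Max a \<or> Min c \<le> x"
        using r[of x] nz z_ends(1) \<open>Min a \<le> Max a\<close> FIN_mem_bounds[OF a, of x] FIN_mem_bounds[OF c, of x]
        by auto
      ultimately show False using ac(3,4) by linarith
    qed
    moreover have "finite t" using tFIN unfolding FIN_def by simp
    moreover have "r \<union> y = t \<union> Y j" unfolding trz y_def ac(5) by blast
    ultimately show ?thesis using block_count_union_block[OF Y(1)] by simp
  qed
  ultimately show False using T(2) even_Suc by metis
qed

end

section \<open>Strictness of the Tukey reduction\<close>

lemma not_tukey_le_minmax_image: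
  assumes "stable_ordered_union U"
  shows "\<not> U \<le>\<^sub>T minmax_image U"
proof
  assume le: "U \<le>\<^sub>T minmax_image U"
  have "ordered_union U" using assms unfolding stable_ordered_union_def by simp
  from le this show False
  proof (rule tukey_le_minmax_image_reduction)
    fix H
    assume "\<And>A B S. S \<in> U \<Longrightarrow> Min ` S \<subseteq> A \<Longrightarrow> Max ` S \<subseteq> B \<Longrightarrow> H A B \<in> U"
      "\<And>A B A' B'. A \<subseteq> A' \<Longrightarrow> B \<subseteq> B' \<Longrightarrow> H A B \<subseteq> H A' B'"
      "\<And>T. T \<in> U \<Longrightarrow> \<exists>S\<in>U. H (Min ` S) (Max ` S) \<subseteq> T"
    with assms have "minmax_cofinal_map U H" by unfold_locales
    then show False by (rule minmax_cofinal_map.contradiction)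
  qed
qed

theorem theorem3p6:
  fixes U :: "nat set set set"
  assumes "stable_ordered_union U"
  shows "minmax_image U \<le>\<^sub>T U \<and> \<not> U \<le>\<^sub>T minmax_image U"
proof
  have "ultrafilter_on FIN U"
    using assms ordered_union_ultrafilter unfolding stable_ordered_union_def by simp
  then show "minmax_image U \<le>\<^sub>T U" by (rule minmax_image_tukey_le)
  show "\<not> U \<le>\<^sub>T minmax_image U" by (rule not_tukey_le_minmax_image[OF assms])
qed

end
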